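(* Let $\Pi=\{2431,2143,3142,4132,1432,1342,1324,1423,1243\}$. Then $$\sum_{n\ge 0}|\operatorname{Av}_n(\Pi)|\,x^n = C+x^3C,$$ where $C=C(x)$ is the generating function of the Catalan numbers.
   Context: $\operatorname{Av}_n(\Pi)$ is the set of permutations of $[n]$ that avoid (in the classical sense) every pattern in $\Pi$: a permutation $\pi$ contains $p\in S_k$ if some subsequence of $\pi$ of length $k$ is in the same relative order as $p$, and avoids $p$ otherwise. Generating functions are ordinary; $C(x)=\sum_{n\ge0}\frac{1}{n+1}\binom{2n}{n}x^n$. *)

theory Defs
  imports
    "HOL-Library.Sublist"
    "HOL-Combinatorics.Multiset_Permutations"
    "HOL-Computational_Algebra.Formal_Power_Series"
begin

text \<open>Permutations of \<open>[n]\<close>, and patterns, are lists in one-line notation: the permutations of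
  \<open>[n]\<close> are the elements of \<^term>\<open>permutations_of_set {1..n::nat}\<close>.\<close>

definition same_relative_order :: "nat list \<Rightarrow> nat list \<Rightarrow> bool" where
  "same_relative_order xs ys \<longleftrightarrow> length xs = length ys \<and>
     (\<forall>i<length xs. \<forall>j<length xs. xs ! i < xs ! j \<longleftrightarrow> ys ! i < ys ! j)"

definition contains_pattern :: "nat list \<Rightarrow> nat list \<Rightarrow> bool" where
  "contains_pattern w p \<longleftrightarrow> (\<exists>s. subseq s w \<and> same_relative_order s p)"

definition Av :: "nat list set \<Rightarrow> nat \<Rightarrow> nat list set" where
  "Av P n = {w \<in> permutations_of_set {1..n}. \<forall>p\<in>P. \<not> contains_pattern w p}"

definition catalan_fps :: "rat fps" where
  "catalan_fps = Abs_fps (\<lambda>n. 1 / of_nat (n + 1) * of_nat ((2 * n) choose n))"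

end

theory Submission
  imports Defs
begin

text \<open>Of the ten patterns of length 4 that contain 132, only 2413 is allowed. Hence a permutation of
  \<open>[n]\<close> in the class either avoids 132, or has an occurrence \<open>a c b\<close> of 132 that every further
  entry completes to 2413, that is, every further entry lies between \<open>c\<close> and \<open>b\<close> and is smaller
  than \<open>a\<close>. In the second case the permutation is \<open>(n-2) n \<sigma> (n-1)\<close> with \<open>\<sigma>\<close> avoiding 132, so the
  class has \<open>C\<^sub>n + C\<^sub>n\<^sub>-\<^sub>3\<close> members. The 132-avoiders are counted by splitting at the maximum, which
  gives \<open>F = 1 + x F\<^sup>2\<close>; then \<open>D = 1 - 2 x F\<close> has \<open>D\<^sup>2 = 1 - 4 x\<close>, and differentiating gives the
  first-order recurrence of the Catalan numbers.\<close>

section \<open>Permutations avoiding 132\<close>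

definition has132 :: "nat list \<Rightarrow> bool" where
  "has132 w \<longleftrightarrow> (\<exists>a b c. subseq [a, c, b] w \<and> a < b \<and> b < c)"

text \<open>The base \<open>a\<close> is free so that the two blocks around the maximum, which
  occupy adjacent value intervals, are again of this form without standardization.\<close>

definition av132 :: "nat \<Rightarrow> nat \<Rightarrow> nat list set" where
  "av132 a n = {w \<in> permutations_of_set {a..<a + n}. \<not> has132 w}"

lemma has132_mono: "subseq u w \<Longrightarrow> has132 u \<Longrightarrow> has132 w"
  unfolding has132_def by (meson subseq_order.order_trans)

lemma subseq_set: "subseq s w \<Longrightarrow> x \<in> set s \<Longrightarrow> x \<in> set w"
  by (auto elim: list_emb_set)

text \<open>The largest entry \<open>m\<close> can only play the 3. So an occurrence that does not
  lie within \<open>u\<close> or within \<open>v\<close> has its 1 in \<open>u\<close> and its 2 in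
  \<open>v\<close>, which the second assumption forbids.\<close>

lemma has132_insert_max:
  assumes "\<And>x. x \<in> set u \<union> set v \<Longrightarrow> x < m"
    and "\<And>x y. x \<in> set u \<Longrightarrow> y \<in> set v \<Longrightarrow> y < x"
  shows "has132 (u @ m # v) \<longleftrightarrow> has132 u \<or> has132 v"
proof
  assume "has132 (u @ m # v)"
  then obtain a b c where s: "subseq [a, c, b] (u @ m # v)" and ab: "a < b" "b < c"
    unfolding has132_def by blast
  from s obtain s1 s2 where e: "[a, c, b] = s1 @ s2" and s1: "subseq s1 u"
    and s2: "subseq s2 (m # v)" by (rule subseq_appendE)
  have in1: "x \<in> set u" if "x \<in> set s1" for x using subseq_set[OF s1 that] .
  have in2: "x = m \<or> x \<in> set v" if "x \<in> set s2" for x using subseq_set[OF s2 that] by auto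
  from e have "s1 = [] \<and> s2 = [a, c, b] \<or> s1 = [a] \<and> s2 = [c, b] \<or>
      s1 = [a, c] \<and> s2 = [b] \<or> s1 = [a, c, b] \<and> s2 = []"
    by (simp add: Cons_eq_append_conv) blast
  then consider "s1 = []" "s2 = [a, c, b]" | "s1 = [a]" "s2 = [c, b]"
    | "s1 = [a, c]" "s2 = [b]" | "s1 = [a, c, b]" "s2 = []"
    by blast
  then show "has132 u \<or> has132 v"
  proof cases
    case 1
    have "a \<noteq> m" using in2[of b] in2[of c] assms(1) ab 1 by fastforce
    with s2 1 have "subseq [a, c, b] v" by (simp split: if_splits)
    then show ?thesis using ab unfolding has132_def by blast
  next
    case 2
    then show ?thesis using in1[of a] in2[of b] in2[of c] assms(1)[of a] assms(1)[of c]
        assms(2)[of a b] ab by fastforce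
  next
    case 3
    then show ?thesis using in1[of a] in1[of c] in2[of b] assms(1)[of c] assms(2)[of a b] ab
      by fastforce
  next
    case 4
    then show ?thesis using s1 ab unfolding has132_def by blast
  qed
next
  assume "has132 u \<or> has132 v"
  then show "has132 (u @ m # v)"
    using has132_mono[OF subseq_rev_drop_many[OF subseq_order.order_refl], of u "m # v"]
      has132_mono[OF subseq_drop_many[OF subseq_order.order_refl], of v "u @ [m]"] by auto
qed

text \<open>The cut point is \<open>Min A\<close>: everything in the interval below it must be in
  \<open>B\<close>, everything from it on in \<open>A\<close>.\<close>

lemma interval_split_by_order:
  fixes a b :: nat
  assumes un: "A \<union> B = {a..<b}" and lt: "\<And>x y. x \<in> A \<Longrightarrow> y \<in> B \<Longrightarrow> y < x"
  shows "B = {a..<a + card B}" "A = {a + card B..<b}"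
proof -
  have fin: "finite A" by (metis un finite_Un finite_atLeastLessThan)
  have "\<exists>t. a \<le> t \<and> B = {a..<t} \<and> A = {t..<b}"
  proof (cases "A = {}")
    case True
    \<comment> \<open>With \<open>A\<close> empty the cut is \<open>b\<close>, except that
      \<open>b < a\<close> is possible and the cut must be at least \<open>a\<close>.\<close>
    then show ?thesis using un by (intro exI[of _ "max a b"]) (auto simp: max_def)
  next
    case False
    have mem: "x \<in> A \<or> x \<in> B \<longleftrightarrow> a \<le> x \<and> x < b" for x using un by auto
    have M: "Min A \<in> A" "\<And>x. x \<in> A \<Longrightarrow> Min A \<le> x" using fin False by auto
    show ?thesis
      using M mem lt by (intro exI[of _ "Min A"]) (auto, (meson leD le_trans less_imp_le less_le_trans)+)
  qed
  then obtain t where "a \<le> t" "B = {a..<t}" "A = {t..<b}" by blast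
  then show "B = {a..<a + card B}" "A = {a + card B..<b}" by auto
qed

text \<open>An entry before the maximum that is smaller than an entry after it would form a 132 with
  the maximum in the middle. So the part after the maximum takes the \<open>k\<close> smallest
  values, and \<open>has132_insert_max\<close> applies.\<close>

lemma av132_Suc:
  "av132 a (Suc n) =
    (\<Union>k\<le>n. (\<lambda>(u, v). u @ (a + n) # v) ` (av132 (a + k) (n - k) \<times> av132 a k))"
  (is "_ = ?R")
proof (intro equalityI subsetI)
  fix w assume w: "w \<in> av132 a (Suc n)"
  then have sw: "set w = {a..<a + Suc n}" and dw: "distinct w" and nw: "\<not> has132 w"
    by (auto simp: av132_def permutations_of_set_def)
  have "a + n \<in> set w" using sw by auto
  then obtain u v where wuv: "w = u @ (a + n) # v" by (meson split_list)
  have un: "set u \<union> set v = {a..<a + n}"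
  proof -
    have "set u \<union> set v = set w - {a + n}" using dw unfolding wuv by auto
    also have "\<dots> = {a..<a + n}" unfolding sw by auto
    finally show ?thesis .
  qed
  have lt: "y < x" if "x \<in> set u" "y \<in> set v" for x y
  proof (rule ccontr)
    assume "\<not> y < x"
    then have "x < y" using that dw wuv by (cases "x = y") auto
    moreover have "y < a + n" using un that by auto
    moreover have "subseq ([x] @ [a + n, y]) w" unfolding wuv
      using that by (intro list_emb_append_mono) (auto simp: subseq_singleton_left)
    ultimately have "has132 w" unfolding has132_def append.simps by blast
    with nw show False ..
  qed
  note split = interval_split_by_order[OF un lt]
  have dv: "card (set v) = length v" using dw wuv by (simp add: distinct_card)
  have le: "length v \<le> n" using dv card_mono[of "{a..<a+n}" "set v"] un by auto
  have "\<not> has132 u \<and> \<not> has132 v"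
    using nw has132_insert_max[of u v "a + n"] un lt unfolding wuv by fastforce
  then have "u \<in> av132 (a + length v) (n - length v)" "v \<in> av132 a (length v)"
    using split dw le unfolding av132_def permutations_of_set_def wuv dv by auto
  then show "w \<in> ?R" using le wuv by (intro UN_I[of "length v"]) auto
next
  fix w assume "w \<in> ?R"
  then obtain k u v where k: "k \<le> n" and w: "w = u @ (a + n) # v"
    and u: "u \<in> av132 (a + k) (n - k)" and v: "v \<in> av132 a k" by auto
  from u v k have su: "set u = {a + k..<a + n}" "set v = {a..<a + k}" "distinct u" "distinct v"
    "\<not> has132 u" "\<not> has132 v" by (auto simp: av132_def permutations_of_set_def)
  have "\<not> has132 w" unfolding w using su k by (subst has132_insert_max) auto
  then show "w \<in> av132 a (Suc n)" unfolding av132_def permutations_of_set_def w using su k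
    by auto
qed

lemma finite_av132: "finite (av132 a n)"
  unfolding av132_def by simp

lemma length_av132: "w \<in> av132 a n \<Longrightarrow> length w = n"
  unfolding av132_def permutations_of_set_def by (auto simp flip: distinct_card)

lemma set_av132: "w \<in> av132 a n \<Longrightarrow> set w = {a..<a + n}"
  unfolding av132_def permutations_of_set_def by auto

text \<open>The maximum occurs once, so a word determines both of its parts, and \<open>k\<close> is
  the length of the second one.\<close>

lemma card_av132_Suc:
  "card (av132 a (Suc n)) = (\<Sum>k\<le>n. card (av132 (a + k) (n - k)) * card (av132 a k))"
proof -
  let ?f = "\<lambda>(u, v). u @ (a + n) # v"
  let ?P = "\<lambda>k. av132 (a + k) (n - k) \<times> av132 a k"
  have inj: "u = u' \<and> v = v'"
    if "(u, v) \<in> ?P k" "(u', v') \<in> ?P j" "k \<le> n" "j \<le> n" "u @ (a + n) # v = u' @ (a + n) # v'"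
    for u v u' v' k j
  proof -
    have "a + n \<notin> set u" "a + n \<notin> set v" using that by (auto dest!: set_av132)
    then show ?thesis using that(5) by (subst (asm) append_Cons_eq_iff) auto
  qed
  have disj: "?f ` ?P k \<inter> ?f ` ?P j = {}" if "k \<le> n" "j \<le> n" "k \<noteq> j" for k j
  proof (rule ccontr)
    assume "?f ` ?P k \<inter> ?f ` ?P j \<noteq> {}"
    then obtain u v u' v' where uv: "(u, v) \<in> ?P k" "(u', v') \<in> ?P j"
      "u @ (a + n) # v = u' @ (a + n) # v'" by auto
    then have "v = v'" using inj that by blast
    then show False using uv that length_av132[of v a k] length_av132[of v' a j] by auto
  qed
  have "card (av132 a (Suc n)) = (\<Sum>k\<le>n. card (?f ` ?P k))"
    unfolding av132_Suc using disj by (intro card_UN_disjoint) (simp_all add: finite_av132)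
  also have "\<dots> = (\<Sum>k\<le>n. card (?P k))"
    by (intro sum.cong refl card_image inj_onI) (use inj in fast)
  finally show ?thesis by (simp add: card_cartesian_product)
qed

text \<open>The base enters the recursion only through smaller instances, so strong induction
  removes it; the recursion then becomes a Cauchy product.\<close>

lemma card_av132_shift: "card (av132 a n) = card (av132 b n)"
proof (induction n arbitrary: a b rule: less_induct)
  case (less n)
  show ?case
  proof (cases n)
    case 0
    then show ?thesis by (simp add: av132_def)
  next
    case (Suc m)
    show ?thesis unfolding Suc card_av132_Suc
      by (intro sum.cong refl arg_cong2[where f = "(*)"] less) (auto simp: Suc)
  qed
qed

section \<open>The Catalan generating function\<close>

lemma catalan_fps_unique:
  assumes F: "F = 1 + fps_X * F ^ 2"
  shows "F = catalan_fps"
proof -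
  define D where "D = 1 - 2 * fps_X * F"
  have D2: "D ^ 2 = 1 - 4 * fps_X"
  proof -
    have "D ^ 2 = 1 - 4 * fps_X * (F - fps_X * F ^ 2)"
      unfolding D_def by (simp add: power2_eq_square algebra_simps)
    also have "F - fps_X * F ^ 2 = 1" using F by (simp add: algebra_simps)
    finally show ?thesis by simp
  qed
  have "fps_deriv (D ^ 2) = - 4" unfolding D2 by simp
  then have "2 * (D * fps_deriv D) = 2 * (- 2)" by (simp add: power2_eq_square algebra_simps)
  then have "D * fps_deriv D = - 2" by (subst (asm) mult_cancel_left) simp
  \<comment> \<open>Multiplying by \<open>D\<close> once more lets \<open>D ^ 2\<close> be replaced
    by its polynomial value, which leaves a linear differential equation.\<close>
  then have "fps_deriv D * (D ^ 2) = - 2 * D" by (simp add: power2_eq_square algebra_simps)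
  then have ode: "fps_deriv D - 4 * (fps_X * fps_deriv D) = - 2 * D"
    unfolding D2 by (simp add: algebra_simps)
  have Dn: "fps_nth D (Suc n) = - 2 * fps_nth F n" for n
    unfolding D_def by (simp add: mult.assoc fps_numeral_fps_const)
  \<comment> \<open>Coefficient \<open>Suc n\<close> of the differential equation; it involves
    coefficients \<open>n + 2\<close> and \<open>n + 1\<close> of \<open>D\<close>, which by
    \<open>Dn\<close> are those of \<open>F\<close> one index lower.\<close>
  have rec: "of_nat (n + 2) * fps_nth F (Suc n) = of_nat (4 * n + 2) * fps_nth F n" for n
  proof -
    have "fps_nth (fps_deriv D - 4 * (fps_X * fps_deriv D)) (Suc n) = fps_nth (- 2 * D) (Suc n)"
      unfolding ode ..
    then show ?thesis by (simp add: fps_numeral_fps_const Dn algebra_simps del: fps_const_neg)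
  qed
  have "fps_nth F n = fps_nth catalan_fps n" for n
  proof (induction n)
    case 0
    then show ?case by (subst F) (simp add: catalan_fps_def)
  next
    case (Suc n)
    \<comment> \<open>The ratio of consecutive central binomial coefficients, from two absorption
      identities via the intermediate \<open>Suc (2 * n) choose n\<close>. Chaining them costs an
      extra factor \<open>Suc n\<close>, cancelled at the end.\<close>
    have "Suc n * ((2 * Suc n) choose Suc n) = 2 * ((2 * n + 1) * ((2 * n) choose n))"
    proof -
      have "Suc n * ((2 * Suc n) choose Suc n) = Suc (Suc (2 * n)) * (Suc (2 * n) choose n)"
        using Suc_times_binomial_eq[of "Suc (2 * n)" n] by (simp add: ac_simps)
      moreover have "Suc n * (Suc (2 * n) choose n) = Suc (2 * n) * (2 * n choose n)"
        using binomial_absorb_comp[of "Suc (2 * n)" n] by (simp add: Suc_diff_le)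
      ultimately have "Suc n * (Suc n * ((2 * Suc n) choose Suc n))
          = Suc n * (2 * ((2 * n + 1) * ((2 * n) choose n)))"
        by (simp add: algebra_simps)
      then show ?thesis by (metis mult_cancel1 nat.distinct(1))
    qed
    then have "of_nat (Suc n) * of_nat ((2 * Suc n) choose Suc n)
        = (2 * ((2 * of_nat n + 1) * of_nat ((2 * n) choose n)) :: rat)"
      by (metis (no_types, lifting) of_nat_mult of_nat_add of_nat_numeral of_nat_1)
    then have "of_nat (Suc n) * (of_nat (n + 2) * fps_nth F (Suc n))
        = of_nat (Suc n) * of_nat ((2 * Suc n) choose Suc n)"
      unfolding rec Suc by (simp add: catalan_fps_def field_simps del: binomial_Suc_Suc mult_Suc_right)
    then have "of_nat (n + 2) * fps_nth F (Suc n) = of_nat ((2 * Suc n) choose Suc n)"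
      by (simp del: binomial_Suc_Suc mult_Suc_right of_nat_Suc)
    then show ?case
      by (simp add: catalan_fps_def field_simps del: binomial_Suc_Suc mult_Suc_right)
  qed
  then show ?thesis by (simp add: fps_eq_iff)
qed

lemma card_av132_fps: "Abs_fps (\<lambda>n. of_nat (card (av132 a n))) = catalan_fps"
proof (rule catalan_fps_unique)
  let ?F = "Abs_fps (\<lambda>n. of_nat (card (av132 a n))) :: rat fps"
  show "?F = 1 + fps_X * ?F ^ 2"
  proof (rule fps_ext)
    fix n
    show "fps_nth ?F n = fps_nth (1 + fps_X * ?F ^ 2) n"
    proof (cases n)
      case 0
      have "av132 a 0 = {[]}" by (auto simp: av132_def has132_def)
      then show ?thesis using 0 by simp
    next
      case (Suc m)
      have "card (av132 a (Suc m)) = (\<Sum>k\<le>m. card (av132 a k) * card (av132 a (m - k)))"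
        unfolding card_av132_Suc by (intro sum.cong refl) (metis card_av132_shift mult.commute)
      then show ?thesis
        by (simp add: Suc power2_eq_square fps_mult_nth[of ?F] atLeast0AtMost)
    qed
  qed
qed

section \<open>Structure of the class\<close>

text \<open>Disjuncts are in the order of the patterns 2431, 2143, 3142, 4132, 1432, 1342, 1324, 1423, 1243.\<close>

definition bad :: "nat \<Rightarrow> nat \<Rightarrow> nat \<Rightarrow> nat \<Rightarrow> bool" where
  "bad p q r s \<longleftrightarrow>
     s < p \<and> p < r \<and> r < q \<or> q < p \<and> p < s \<and> s < r \<or> q < s \<and> s < p \<and> p < r \<or>
     q < s \<and> s < r \<and> r < p \<or> p < s \<and> s < r \<and> r < q \<or> p < s \<and> s < q \<and> q < r \<or>
     p < r \<and> r < q \<and> q < s \<or> p < r \<and> r < s \<and> s < q \<or> p < q \<and> q < s \<and> s < r"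

section \<open>Containment of the nine patterns as inequalities between four entries\<close>

definition patterns :: "nat list set" where
  "patterns = {[2,4,3,1], [2,1,4,3], [3,1,4,2], [4,1,3,2], [1,4,3,2],
               [1,3,4,2], [1,3,2,4], [1,4,2,3], [1,2,4,3]}"

lemma same_relative_order_patterns:
  "same_relative_order [p, q, r, s] [2, 4, 3, 1] \<longleftrightarrow> s < p \<and> p < r \<and> r < q"
  "same_relative_order [p, q, r, s] [2, 1, 4, 3] \<longleftrightarrow> q < p \<and> p < s \<and> s < r"
  "same_relative_order [p, q, r, s] [3, 1, 4, 2] \<longleftrightarrow> q < s \<and> s < p \<and> p < r"
  "same_relative_order [p, q, r, s] [4, 1, 3, 2] \<longleftrightarrow> q < s \<and> s < r \<and> r < p"
  "same_relative_order [p, q, r, s] [1, 4, 3, 2] \<longleftrightarrow> p < s \<and> s < r \<and> r < q"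
  "same_relative_order [p, q, r, s] [1, 3, 4, 2] \<longleftrightarrow> p < s \<and> s < q \<and> q < r"
  "same_relative_order [p, q, r, s] [1, 3, 2, 4] \<longleftrightarrow> p < r \<and> r < q \<and> q < s"
  "same_relative_order [p, q, r, s] [1, 4, 2, 3] \<longleftrightarrow> p < r \<and> r < s \<and> s < q"
  "same_relative_order [p, q, r, s] [1, 2, 4, 3] \<longleftrightarrow> p < q \<and> q < s \<and> s < r"
  by (simp_all add: same_relative_order_def All_less_Suc2)
    (rule iffI; elim conjE; intro conjI; linarith)+

lemma length_4_iff: "length xs = 4 \<longleftrightarrow> (\<exists>p q r s. xs = [p, q, r, s])"
  by (auto simp: numeral_eq_Suc length_Suc_conv)

lemma contains_patterns_iff:
  "(\<exists>p\<in>patterns. contains_pattern w p) \<longleftrightarrow> (\<exists>p q r s. subseq [p, q, r, s] w \<and> bad p q r s)"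
proof -
  have bad: "(\<exists>t\<in>patterns. same_relative_order [p, q, r, s] t) \<longleftrightarrow> bad p q r s" for p q r s
    unfolding patterns_def bad_def by (simp add: same_relative_order_patterns del: One_nat_def)
  have "length t = 4" if "t \<in> patterns" for t using that unfolding patterns_def by auto
  then have "\<exists>p q r s. xs = [p, q, r, s]" if "t \<in> patterns" "same_relative_order xs t" for xs t
    using that unfolding same_relative_order_def length_4_iff[symmetric] by simp
  with bad have *: "(\<exists>t\<in>patterns. same_relative_order xs t)
      \<longleftrightarrow> (\<exists>p q r s. xs = [p, q, r, s] \<and> bad p q r s)" for xs
    by blast
  have "(\<exists>p\<in>patterns. contains_pattern w p)
      \<longleftrightarrow> (\<exists>xs. subseq xs w \<and> (\<exists>t\<in>patterns. same_relative_order xs t))"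
    unfolding contains_pattern_def by blast
  then show ?thesis unfolding * by blast
qed

lemma Av_patterns_iff:
  "w \<in> Av patterns n \<longleftrightarrow> w \<in> permutations_of_set {1..n} \<and>
     (\<forall>p q r s. subseq [p, q, r, s] w \<longrightarrow> \<not> bad p q r s)"
proof -
  have "(\<forall>p\<in>patterns. \<not> contains_pattern w p) \<longleftrightarrow> \<not> (\<exists>p\<in>patterns. contains_pattern w p)"
    by blast
  then show ?thesis unfolding Av_def contains_patterns_iff by simp
qed

text \<open>The four cases are the four ways to omit one position: in each of the nine patterns one
  of the remaining triples is a 132.\<close>

lemma bad_has132:
  assumes "bad p q r s"
  shows "has132 [p, q, r, s]"
proof -
  have has132I: "has132 [p, q, r, s]" if "subseq [a, c, b] [p, q, r, s]" "a < b" "b < c" for a b c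
    unfolding has132_def using that by blast
  from assms consider "p < r" "r < q" | "p < s" "s < q" | "p < s" "s < r" | "q < s" "s < r"
    unfolding bad_def by (elim disjE) (meson less_trans)+
  then show ?thesis
  proof cases
    case 1
    then show ?thesis by (intro has132I[of p q r]) auto
  next
    case 2
    then show ?thesis by (intro has132I[of p q s]) auto
  next
    case 3
    then show ?thesis by (intro has132I[of p r s]) auto
  next
    case 4
    then show ?thesis by (intro has132I[of q r s]) auto
  qed
qed

section \<open>Members of the class that contain 132\<close>

text \<open>Only \<open>a\<close>, \<open>b\<close>, \<open>c\<close> reach the value
  \<open>a\<close> or more, so \<open>a + 1\<close> can only be \<open>b\<close>,
  \<open>b + 1\<close> can only be \<open>c\<close>, and \<open>n\<close> can only be
  \<open>c\<close>.\<close>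

lemma interval_top:
  fixes a b c n :: nat
  assumes eq: "{a, b, c} \<union> S = {1..n}" and S: "\<And>x. x \<in> S \<Longrightarrow> x < a" and ab: "a < b" "b < c"
  shows "c = n" "b = n - 1" "a = n - 2" "3 \<le> n" "S = {1..<1 + (n - 3)}"
proof -
  have mem: "x = a \<or> x = b \<or> x = c \<or> x \<in> S \<longleftrightarrow> 1 \<le> x \<and> x \<le> n" for x
    unfolding atLeastAtMost_iff[symmetric] eq[symmetric] by simp
  have le: "c \<le> n" "b \<le> n" "1 \<le> a" using mem by blast+
  have "b = a + 1"
    using mem[of "a + 1"] S[of "a + 1"] ab le by linarith
  moreover have "c = b + 1"
    using mem[of "b + 1"] S[of "b + 1"] ab le by linarith
  moreover have "n = c"
    using mem[of "n"] S[of "n"] ab le by linarith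
  ultimately have *: "b = a + 1" "c = b + 1" "n = c" .
  then show "c = n" "b = n - 1" "a = n - 2" "3 \<le> n" using le by auto
  show "S = {1..<1 + (n - 3)}"
  proof (intro set_eqI iffI)
    fix x assume "x \<in> S"
    with mem[of x] S[of x] show "x \<in> {1..<1 + (n - 3)}" unfolding * by simp
  next
    fix x assume "x \<in> {1..<1 + (n - 3)}"
    then have "1 \<le> x" "x < a" unfolding * using le by auto
    with mem[of x] show "x \<in> S" unfolding * by simp
  qed
qed

lemma subseq_3_split:
  assumes "subseq [a, c, b] w"
  obtains w0 w1 w2 w3 where "w = w0 @ a # w1 @ c # w2 @ b # w3"
proof -
  from list_emb_ConsD[OF assms] obtain w0 u where w: "w = w0 @ a # u" and "subseq [c, b] u"
    by blast
  from list_emb_ConsD[OF this(2)] obtain w1 v where u: "u = w1 @ c # v" and "subseq [b] v"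
    by blast
  from list_emb_ConsD[OF this(2)] obtain w2 w3 where "v = w2 @ b # w3"
    by blast
  with w u that show thesis by simp
qed

text \<open>A further entry \<open>x\<close> is tested in each gap of an occurrence
  \<open>a c b\<close>. Before \<open>a\<close>, between \<open>a\<close> and \<open>c\<close>, and
  after \<open>b\<close>, all four relative sizes of \<open>x\<close> give a forbidden pattern;
  between \<open>c\<close> and \<open>b\<close> only \<open>x < a\<close> survives.\<close>

lemma Av_patterns_has132:
  assumes w: "w \<in> Av patterns n" and h: "has132 w"
  shows "3 \<le> n \<and> (\<exists>\<sigma>\<in>av132 1 (n - 3). w = (n - 2) # n # \<sigma> @ [n - 1])"
proof -
  from w have sw: "set w = {1..n}" and dw: "distinct w"
    and nb: "\<And>p q r s. subseq [p, q, r, s] w \<Longrightarrow> \<not> bad p q r s"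
    by (auto simp: Av_patterns_iff permutations_of_set_def)
  from h obtain a b c where ab: "a < b" "b < c" and "subseq [a, c, b] w"
    unfolding has132_def by blast
  then obtain w0 w1 w2 w3 where ww: "w = w0 @ a # w1 @ c # w2 @ b # w3"
    by (meson subseq_3_split)
  have "set w0 = {}"
  proof (rule equals0I)
    fix x assume x: "x \<in> set w0"
    \<comment> \<open>The empty lists pad the subsequence so that it matches the word block by
      block; the other gaps are treated alike.\<close>
    then have "subseq ([x] @ [a] @ [] @ [c] @ [] @ [b] @ []) (w0 @ [a] @ w1 @ [c] @ w2 @ [b] @ w3)"
      by (intro list_emb_append_mono) (auto simp: subseq_singleton_left)
    with nb have "\<not> bad x a c b" unfolding ww by simp
    then show False using x dw ab unfolding ww bad_def by auto
  qed
  then have w0: "w0 = []" by simp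
  have "set w1 = {}"
  proof (rule equals0I)
    fix x assume x: "x \<in> set w1"
    then have "subseq ([] @ [a] @ [x] @ [c] @ [] @ [b] @ []) (w0 @ [a] @ w1 @ [c] @ w2 @ [b] @ w3)"
      by (intro list_emb_append_mono) (auto simp: subseq_singleton_left)
    with nb have "\<not> bad a x c b" unfolding ww by simp
    then show False using x dw ab unfolding ww bad_def by auto
  qed
  then have w1: "w1 = []" by simp
  have "set w3 = {}"
  proof (rule equals0I)
    fix x assume x: "x \<in> set w3"
    then have "subseq ([] @ [a] @ [] @ [c] @ [] @ [b] @ [x]) (w0 @ [a] @ w1 @ [c] @ w2 @ [b] @ w3)"
      by (intro list_emb_append_mono) (auto simp: subseq_singleton_left)
    with nb have "\<not> bad a c b x" unfolding ww by simp
    then show False using x dw ab unfolding ww bad_def by auto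
  qed
  then have w3: "w3 = []" by simp
  have lt: "x < a" if x: "x \<in> set w2" for x
  proof -
    have "subseq ([] @ [a] @ [] @ [c] @ [x] @ [b] @ []) (w0 @ [a] @ w1 @ [c] @ w2 @ [b] @ w3)"
      using x by (intro list_emb_append_mono) (auto simp: subseq_singleton_left)
    with nb have "\<not> bad a c x b" unfolding ww by simp
    then show ?thesis using x dw ab unfolding ww bad_def by auto
  qed
  have www: "w = a # c # w2 @ [b]" using ww w0 w1 w3 by simp
  have nw2: "\<not> has132 w2"
  proof
    assume "has132 w2"
    then obtain p q r where p: "subseq [p, r, q] w2" "p < q" "q < r" unfolding has132_def by blast
    \<comment> \<open>All of \<open>w2\<close> lies below \<open>a\<close>, so a 132 inside it,
      preceded by \<open>a\<close>, is a 4132.\<close>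
    then have "subseq ([a] @ [] @ [p, r, q] @ []) ([a] @ [c] @ w2 @ [b])"
      by (intro list_emb_append_mono) (auto simp: subseq_singleton_left)
    with nb have "\<not> bad a p r q" unfolding www by simp
    moreover have "r < a" using p(1) subseq_set lt by fastforce
    ultimately show False using p unfolding bad_def by auto
  qed
  have "{a, b, c} \<union> set w2 = {1..n}" using sw unfolding www by auto
  note top = interval_top[OF this lt ab]
  have "w2 \<in> av132 1 (n - 3)"
    using dw nw2 top(5) unfolding www av132_def permutations_of_set_def by simp
  moreover have "w = (n - 2) # n # w2 @ [n - 1]" using www top(1-3) by metis
  ultimately show ?thesis using top(4) by blast
qed

text \<open>An occurrence starting at \<open>a\<close> must use the only two larger values.
  Otherwise it lies in \<open>\<sigma> @ [b]\<close>; as \<sigma> avoids 132 it would end in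
  \<open>b\<close>, but then its 3 would be in \<sigma> and too small.\<close>

lemma occurrence132_unique:
  assumes \<sigma>: "\<not> has132 \<sigma>" "\<And>x. x \<in> set \<sigma> \<Longrightarrow> x < a" and ab: "a < b" "b < c"
    and s: "subseq [p, r, q] (a # c # \<sigma> @ [b])" and pq: "p < q" "q < r"
  shows "p = a \<and> q = b \<and> r = c"
proof -
  have in_set: "x = a \<or> x = c \<or> x = b \<or> x \<in> set \<sigma>" if "x \<in> {p, q, r}" for x
    using subseq_set[OF s, of x] that by auto
  have le: "x \<le> c" if "x \<in> {p, q, r}" for x using in_set[OF that] \<sigma>(2)[of x] ab by auto
  have "p \<noteq> c" using le[of r] pq by auto
  show ?thesis
  proof (cases "p = a")
    case True
    then show ?thesis using in_set[of q] in_set[of r] \<sigma>(2)[of q] \<sigma>(2)[of r] pq ab by auto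
  next
    case False
    with s \<open>p \<noteq> c\<close> have "subseq [p, r, q] (\<sigma> @ [b])" by (simp split: if_splits)
    then obtain s1 s2 where e: "[p, r, q] = s1 @ s2" and s1: "subseq s1 \<sigma>"
      and s2: "subseq s2 [b]" by (rule subseq_appendE)
    from s2 have "s2 = [] \<or> s2 = [b]" by (cases s2) (auto split: if_splits)
    then show ?thesis
    proof
      assume "s2 = []"
      then have "subseq [p, r, q] \<sigma>" using e s1 by simp
      then show ?thesis using \<sigma>(1) pq unfolding has132_def by blast
    next
      assume "s2 = [b]"
      then have "q = b" "s1 = [p, r]" using e by (auto simp: Cons_eq_append_conv)
      then have "r \<in> set \<sigma>" using subseq_set[OF s1] by auto
      then show ?thesis using \<sigma>(2)[of r] \<open>q = b\<close> pq ab by auto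
    qed
  qed
qed

text \<open>A forbidden quadruple contains a 132, which by uniqueness has the values
  \<open>n - 2\<close>, \<open>n\<close>, \<open>n - 1\<close>. The fourth entry then has no
  admissible place or value.\<close>

lemma extension_in_Av_patterns:
  assumes n: "3 \<le> n" and \<sigma>: "\<sigma> \<in> av132 1 (n - 3)"
  shows "(n - 2) # n # \<sigma> @ [n - 1] \<in> Av patterns n" (is "?w \<in> _")
    and "has132 ((n - 2) # n # \<sigma> @ [n - 1])"
proof -
  from \<sigma> have s: "set \<sigma> = {1..<1 + (n - 3)}" "distinct \<sigma>" "\<not> has132 \<sigma>"
    by (auto simp: av132_def permutations_of_set_def)
  have d: "distinct ?w" using s n by auto
  have occ: "p = n - 2 \<and> q = n - 1 \<and> r = n" if "subseq [p, r, q] ?w" "p < q" "q < r" for p q r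
    by (rule occurrence132_unique[OF s(3) _ _ _ that]) (use s n in auto)
  have "\<not> bad p q r t" if sub: "subseq [p, q, r, t] ?w" for p q r t
  proof
    assume bad: "bad p q r t"
    have "subseq [p, q, r] [p, q, r, t]" "subseq [p, q, t] [p, q, r, t]"
      "subseq [p, r, t] [p, q, r, t]" "subseq [q, r, t] [p, q, r, t]" by auto
    then have s3: "subseq [p, q, r] ?w" "subseq [p, q, t] ?w" "subseq [p, r, t] ?w"
      "subseq [q, r, t] ?w" using sub by (meson subseq_order.order_trans)+
    have "x \<le> n" if "x \<in> {p, q, r, t}" for x using subseq_set[OF sub, of x] that s n by auto
    then have le: "p \<le> n" "q \<le> n" "r \<le> n" "t \<le> n" by auto
    \<comment> \<open>The value \<open>n - 1\<close> stands last in the word, so it cannot be third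
      of four entries. This handles 2431, whose only 132 fills its first three places.\<close>
    have last: "r \<noteq> n - 1"
    proof
      assume r: "r = n - 1"
      have "subseq [p, q, r, t] (((n - 2) # n # \<sigma>) @ [n - 1])" using sub by simp
      then obtain s1 s2 where e: "[p, q, r, t] = s1 @ s2" and s1: "subseq s1 ((n - 2) # n # \<sigma>)"
        and s2: "subseq s2 [n - 1]" by (rule subseq_appendE)
      from s2 have "length s2 \<le> 1" using list_emb_length by fastforce
      then have "r \<in> set s1" using e by (auto simp: Cons_eq_append_conv)
      then have "r \<in> set ((n - 2) # n # \<sigma>)" using subseq_set[OF s1] by blast
      then show False using r s n by auto
    qed
    show False
      \<comment> \<open>In the other patterns the fourth entry would yield a second occurrence of
        132, exceed \<open>n\<close>, or lie strictly between consecutive values among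
        \<open>n - 2\<close>, \<open>n - 1\<close>, \<open>n\<close>.\<close>
      using bad s3[THEN occ] le last unfolding bad_def by (elim disjE) fastforce+
  qed
  moreover have "set ?w = {1..n}" using s n by auto
  ultimately show "?w \<in> Av patterns n"
    using d by (auto simp: Av_patterns_iff permutations_of_set_def)
  have "subseq ([n - 2] @ [n] @ [] @ [n - 1]) ([n - 2] @ [n] @ \<sigma> @ [n - 1])"
    by (intro list_emb_append_mono) (auto simp: subseq_singleton_left)
  moreover have "n - 2 < n - 1" "n - 1 < n" using n by auto
  ultimately show "has132 ?w" unfolding has132_def append.simps by blast
qed

section \<open>Counting the class\<close>

text \<open>Every forbidden pattern contains 132, so avoiding 132 already implies membership in the
  class.\<close>

lemma Av_patterns_not_has132: "{w \<in> Av patterns n. \<not> has132 w} = av132 1 n"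
proof -
  have "{1..<1 + n} = {1..n}" by auto
  moreover have "\<forall>p q r s. subseq [p, q, r, s] w \<longrightarrow> \<not> bad p q r s" if "\<not> has132 w" for w
    using that bad_has132 has132_mono by blast
  ultimately show ?thesis
    unfolding av132_def Av_patterns_iff by (intro Collect_cong) metis
qed

text \<open>The class splits by containment of 132; the members that contain it are the injective
  image of the 132-avoiders \<sigma> of size \<open>n - 3\<close>.\<close>

lemma card_Av_patterns:
  "card (Av patterns n) = card (av132 1 n) + (if 3 \<le> n then card (av132 1 (n - 3)) else 0)"
proof -
  let ?H = "{w \<in> Av patterns n. has132 w}"
  have "finite (Av patterns n)" by (simp add: Av_def)
  moreover have "Av patterns n = {w \<in> Av patterns n. \<not> has132 w} \<union> ?H" by auto
  ultimately have "card (Av patterns n) = card {w \<in> Av patterns n. \<not> has132 w} + card ?H"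
    by (metis (mono_tags, lifting) card_Un_disjoint disjoint_iff finite_Un mem_Collect_eq)
  moreover have "card ?H = (if 3 \<le> n then card (av132 1 (n - 3)) else 0)"
  proof (cases "3 \<le> n")
    case True
    have "?H = (\<lambda>\<sigma>. (n - 2) # n # \<sigma> @ [n - 1]) ` av132 1 (n - 3)"
      using Av_patterns_has132 extension_in_Av_patterns[OF True] by fastforce
    then show ?thesis using True by (simp add: card_image inj_on_def)
  next
    case False
    then have "?H = {}" using Av_patterns_has132 by blast
    then show ?thesis using False by (simp only: card.empty if_False)
  qed
  ultimately show ?thesis by (simp add: Av_patterns_not_has132)
qed

theorem theorem6p1:
  fixes Pats :: "nat list set"
  defines "Pats \<equiv> {[2,4,3,1], [2,1,4,3], [3,1,4,2], [4,1,3,2], [1,4,3,2],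
                   [1,3,4,2], [1,3,2,4], [1,4,2,3], [1,2,4,3]}"
  shows "Abs_fps (\<lambda>n. of_nat (card (Av Pats n))) = catalan_fps + fps_X ^ 3 * catalan_fps"
proof -
  have "Pats = patterns" by (simp add: Pats_def patterns_def)
  then have "Abs_fps (\<lambda>n. of_nat (card (Av Pats n))) =
      (let F = Abs_fps (\<lambda>n. of_nat (card (av132 1 n))) :: rat fps in F + fps_X ^ 3 * F)"
    \<comment> \<open>The case distinction at \<open>3\<close> in \<open>card_Av_patterns\<close> is
      the coefficient rule for multiplication by \<open>fps_X ^ 3\<close>.\<close>
    by (simp add: fps_eq_iff card_Av_patterns fps_X_power_mult_nth Let_def)
  then show ?thesis by (simp only: card_av132_fps Let_def)
qed

end
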